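(* Let $n\ge 1$. There exists a coassociative coalgebra whose geometric support is (up to graph isomorphism) the line-extension of the $(n,1)$-De Bruijn graph.
   Context: The field $k$ is $\mathbb{R}$ or $\mathbb{C}$. The $(n,1)$-De Bruijn graph is the directed graph with $n$ vertices, with exactly one arrow from $u$ to $v$ for every ordered pair of vertices $(u,v)$ (including loops). The line-extension $E(G)$ of a directed graph $G$ with vertex set $G_0$ and arrow set $G_1\subseteq G_0\times G_0$ is the directed graph with vertex set $G_1$, having an arrow from $(u,v)$ to $(u',v')$ (for $(u,v),(u',v')\in G_1$) if and only if $v=u'$. Geometric support: if a coassociative coalgebra $(L,\Delta)$ is given with a basis $L_0$, its geometric support $Gr(L)$ is the directed graph with vertex set $L_0$ and arrow set the set of tensors $u\otimes v$ ($u,v\in L_0$) appearing with nonzero coefficient in the coproducts $\Delta(w)$, $w\in L_0$; $u\otimes v$ is viewed as an arrow from $u$ to $v$. A graph isomorphism is a pair of bijections on vertices and on arrows compatible with the source and terminus maps. *)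

theory Defs
  imports
    Complex_Main
    "HOL-Library.Poly_Mapping"
    "Graph_Theory.Pair_Digraph"
    "Graph_Theory.Digraph_Isomorphism"
begin

section \<open>Formal linear combinations\<close>

text \<open>The type \<open>'a \<Rightarrow>\<^sub>0 'k\<close> is the vector space over \<open>'k\<close> freely generated by \<open>'a\<close>;
  \<open>Poly_Mapping.single a 1\<close> is the generator belonging to \<open>a\<close>.\<close>

definition formal_scale :: "'k::field \<Rightarrow> ('a \<Rightarrow>\<^sub>0 'k) \<Rightarrow> ('a \<Rightarrow>\<^sub>0 'k)" where
  "formal_scale c f = Poly_Mapping.map ((*) c) f"

lemma lookup_formal_scale [simp]:
  "Poly_Mapping.lookup (formal_scale c f) a = c * Poly_Mapping.lookup f a"
  unfolding formal_scale_def by transfer (auto simp: when_def)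

global_interpretation formal: vector_space "formal_scale :: 'k::field \<Rightarrow> ('a \<Rightarrow>\<^sub>0 'k) \<Rightarrow> ('a \<Rightarrow>\<^sub>0 'k)"
  by standard (auto intro!: poly_mapping_eqI simp: lookup_add algebra_simps)

definition formal_extend :: "('a \<Rightarrow> ('b \<Rightarrow>\<^sub>0 'k)) \<Rightarrow> ('a \<Rightarrow>\<^sub>0 'k::field) \<Rightarrow> ('b \<Rightarrow>\<^sub>0 'k)" where
  "formal_extend g f = (\<Sum>a\<in>Poly_Mapping.keys f. formal_scale (Poly_Mapping.lookup f a) (g a))"

definition formal_concat :: "('a list \<Rightarrow>\<^sub>0 'k::field) \<Rightarrow> ('a list \<Rightarrow>\<^sub>0 'k) \<Rightarrow> ('a list \<Rightarrow>\<^sub>0 'k)" where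
  "formal_concat f g =
     formal_extend (\<lambda>xs. formal_extend (\<lambda>ys. Poly_Mapping.single (xs @ ys) 1) g) f"


section \<open>Tensor powers of a vector space\<close>

text \<open>
  Throughout, the vector space is a subspace \<open>L\<close> of an ambient space with scalar
  multiplication \<open>scale\<close>. Its \<open>m\<close>-th tensor power is constructed in the usual way: the list
  \<open>[x\<^sub>1, \<dots>, x\<^sub>m]\<close> stands for the pure tensor of \<open>x\<^sub>1, \<dots>, x\<^sub>m\<close>, and the space freely
  generated by all such lists is divided by the span of the multilinearity relations. In this
  unbracketed form the associativity isomorphisms of the tensor product are identities.
\<close>

definition formal_tensors :: "'v set \<Rightarrow> nat \<Rightarrow> ('v list \<Rightarrow>\<^sub>0 'k::field) set" where
  "formal_tensors L m = {f. \<forall>xs\<in>Poly_Mapping.keys f. length xs = m \<and> set xs \<subseteq> L}"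

definition multilinear_relations ::
    "('k::field \<Rightarrow> 'v::ab_group_add \<Rightarrow> 'v) \<Rightarrow> 'v set \<Rightarrow> nat \<Rightarrow> ('v list \<Rightarrow>\<^sub>0 'k) set" where
  "multilinear_relations scale L m =
     {Poly_Mapping.single (xs @ [x + y] @ ys) 1
        - Poly_Mapping.single (xs @ [x] @ ys) 1 - Poly_Mapping.single (xs @ [y] @ ys) 1
       | xs x y ys. set xs \<union> {x, y} \<union> set ys \<subseteq> L \<and> length xs + 1 + length ys = m} \<union>
     {Poly_Mapping.single (xs @ [scale c x] @ ys) 1
        - formal_scale c (Poly_Mapping.single (xs @ [x] @ ys) 1)
       | xs c x ys. set xs \<union> {x} \<union> set ys \<subseteq> L \<and> length xs + 1 + length ys = m}"

definition tensor_eq ::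
    "('k::field \<Rightarrow> 'v::ab_group_add \<Rightarrow> 'v) \<Rightarrow> 'v set \<Rightarrow> nat \<Rightarrow> ('v list \<Rightarrow>\<^sub>0 'k) rel" where
  "tensor_eq scale L m =
     {(f, g). f \<in> formal_tensors L m \<and> g \<in> formal_tensors L m
        \<and> f - g \<in> formal.span (multilinear_relations scale L m)}"

definition tensor_class ::
    "('k::field \<Rightarrow> 'v::ab_group_add \<Rightarrow> 'v) \<Rightarrow> 'v set \<Rightarrow> nat \<Rightarrow> ('v list \<Rightarrow>\<^sub>0 'k) \<Rightarrow> ('v list \<Rightarrow>\<^sub>0 'k) set"
  where "tensor_class scale L m f = tensor_eq scale L m `` {f}"

definition tensor_power ::
    "('k::field \<Rightarrow> 'v::ab_group_add \<Rightarrow> 'v) \<Rightarrow> 'v set \<Rightarrow> nat \<Rightarrow> ('v list \<Rightarrow>\<^sub>0 'k) set set" where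
  "tensor_power scale L m = formal_tensors L m // tensor_eq scale L m"

text \<open>The operations on classes are computed on representatives; by the relations that
  have been divided out, the results do not depend on the choice made by \<open>tensor_rep\<close>
  (in \<open>tensor_map\<close>: provided that the two maps are linear).\<close>

definition tensor_rep :: "('v list \<Rightarrow>\<^sub>0 'k::field) set \<Rightarrow> ('v list \<Rightarrow>\<^sub>0 'k)" where
  "tensor_rep A = (SOME f. f \<in> A)"

definition tensor_add ::
    "('k::field \<Rightarrow> 'v::ab_group_add \<Rightarrow> 'v) \<Rightarrow> 'v set \<Rightarrow> nat \<Rightarrow>
      ('v list \<Rightarrow>\<^sub>0 'k) set \<Rightarrow> ('v list \<Rightarrow>\<^sub>0 'k) set \<Rightarrow> ('v list \<Rightarrow>\<^sub>0 'k) set" where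
  "tensor_add scale L m A B = tensor_class scale L m (tensor_rep A + tensor_rep B)"

definition tensor_scale ::
    "('k::field \<Rightarrow> 'v::ab_group_add \<Rightarrow> 'v) \<Rightarrow> 'v set \<Rightarrow> nat \<Rightarrow>
      'k \<Rightarrow> ('v list \<Rightarrow>\<^sub>0 'k) set \<Rightarrow> ('v list \<Rightarrow>\<^sub>0 'k) set" where
  "tensor_scale scale L m c A = tensor_class scale L m (formal_scale c (tensor_rep A))"

definition linear_to_tensor_power ::
    "('k::field \<Rightarrow> 'v::ab_group_add \<Rightarrow> 'v) \<Rightarrow> 'v set \<Rightarrow> nat \<Rightarrow> ('v \<Rightarrow> ('v list \<Rightarrow>\<^sub>0 'k) set) \<Rightarrow> bool" where
  "linear_to_tensor_power scale L m \<phi> \<longleftrightarrow>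
     (\<forall>x\<in>L. \<phi> x \<in> tensor_power scale L m) \<and>
     (\<forall>x\<in>L. \<forall>y\<in>L. \<phi> (x + y) = tensor_add scale L m (\<phi> x) (\<phi> y)) \<and>
     (\<forall>c. \<forall>x\<in>L. \<phi> (scale c x) = tensor_scale scale L m c (\<phi> x))"

text \<open>The identity of \<open>L\<close>, as a map into the first tensor power.\<close>

definition tensor_id ::
    "('k::field \<Rightarrow> 'v::ab_group_add \<Rightarrow> 'v) \<Rightarrow> 'v set \<Rightarrow> 'v \<Rightarrow> ('v list \<Rightarrow>\<^sub>0 'k) set" where
  "tensor_id scale L x = tensor_class scale L 1 (Poly_Mapping.single [x] 1)"

text \<open>For linear maps \<open>\<phi>\<close> and \<open>\<psi>\<close> from \<open>L\<close> to two tensor powers of \<open>L\<close>, their tensor product: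
  the linear map from the second tensor power of \<open>L\<close> to the \<open>m\<close>-th one which sends the class
  of \<open>[x, y]\<close> to the tensor product of \<open>\<phi> x\<close> and \<open>\<psi> y\<close>; here \<open>m\<close> is the sum of the degrees of
  \<open>\<phi>\<close> and \<open>\<psi>\<close>.\<close>

definition tensor_map ::
    "('k::field \<Rightarrow> 'v::ab_group_add \<Rightarrow> 'v) \<Rightarrow> 'v set \<Rightarrow> nat \<Rightarrow>
      ('v \<Rightarrow> ('v list \<Rightarrow>\<^sub>0 'k) set) \<Rightarrow> ('v \<Rightarrow> ('v list \<Rightarrow>\<^sub>0 'k) set) \<Rightarrow>
      ('v list \<Rightarrow>\<^sub>0 'k) set \<Rightarrow> ('v list \<Rightarrow>\<^sub>0 'k) set" where
  "tensor_map scale L m \<phi> \<psi> A =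
     tensor_class scale L m
       (formal_extend (\<lambda>l. formal_concat (tensor_rep (\<phi> (l ! 0))) (tensor_rep (\<psi> (l ! 1))))
         (tensor_rep A))"


section \<open>Coassociative coalgebras and their geometric support\<close>

text \<open>No counit is part of the structure.\<close>

locale coassociative_coalgebra = vector_space scale
  for scale :: "'k::field \<Rightarrow> 'v::ab_group_add \<Rightarrow> 'v" +
  fixes L :: "'v set" and \<Delta> :: "'v \<Rightarrow> ('v list \<Rightarrow>\<^sub>0 'k) set"
  assumes subspace_L: "subspace L"
    and linear_\<Delta>: "linear_to_tensor_power scale L 2 \<Delta>"
    and coassociative:
      "x \<in> L \<Longrightarrow> tensor_map scale L 3 \<Delta> (tensor_id scale L) (\<Delta> x)
                 = tensor_map scale L 3 (tensor_id scale L) \<Delta> (\<Delta> x)"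

definition (in vector_space) basis_of :: "'b set \<Rightarrow> 'b set \<Rightarrow> bool" where
  "basis_of B L \<longleftrightarrow> B \<subseteq> L \<and> independent B \<and> span B = L"

text \<open>If \<open>B\<close> is a basis of \<open>L\<close>, the pure tensors of pairs of elements of \<open>B\<close> form a basis of
  the second tensor power. So among the formal combinations representing \<open>\<Delta> w\<close> there is
  exactly one that involves only such pairs, and its coefficients are those of \<open>\<Delta> w\<close>.\<close>

definition appears_in ::
    "'v set \<Rightarrow> 'v \<Rightarrow> 'v \<Rightarrow> ('v list \<Rightarrow>\<^sub>0 'k::field) set \<Rightarrow> bool" where
  "appears_in B u v A \<longleftrightarrow>
     (\<exists>f\<in>A. Poly_Mapping.keys f \<subseteq> {[a, b] | a b. a \<in> B \<and> b \<in> B} \<and> Poly_Mapping.lookup f [u, v] \<noteq> 0)"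

definition geometric_support ::
    "'v set \<Rightarrow> ('v \<Rightarrow> ('v list \<Rightarrow>\<^sub>0 'k::field) set) \<Rightarrow> 'v pair_pre_digraph" where
  "geometric_support B \<Delta> =
     \<lparr>pverts = B, parcs = {(u, v). u \<in> B \<and> v \<in> B \<and> (\<exists>w\<in>B. appears_in B u v (\<Delta> w))}\<rparr>"


section \<open>De Bruijn graphs and line-extensions\<close>

definition de_bruijn_1 :: "nat \<Rightarrow> nat pair_pre_digraph" where
  "de_bruijn_1 n = \<lparr>pverts = {..<n}, parcs = {..<n} \<times> {..<n}\<rparr>"

definition line_extension :: "'a pair_pre_digraph \<Rightarrow> ('a \<times> 'a) pair_pre_digraph" where
  "line_extension G =
     \<lparr>pverts = parcs G,
      parcs = {((u, v), (u', v')) | u v u' v'. (u, v) \<in> parcs G \<and> (u', v') \<in> parcs G \<and> v = u'}\<rparr>"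

end

theory Submission
  imports Defs
begin

text \<open>
  The coalgebra is that of \<open>n \<times> n\<close> matrices: its basis consists of the matrix units \<open>E (i, j)\<close>, and
  \<open>\<Delta> (E (i, k)) = \<Sum>j. E (i, j) \<otimes> E (j, k)\<close>. A matrix unit is an arrow of the De Bruijn graph, that is a vertex
  of its line-extension, and the coproduct of \<open>E (i, k)\<close> runs through the composable pairs of arrows
  that lead from \<open>i\<close> to \<open>k\<close>. Over all \<open>i\<close> and \<open>k\<close> these are all the composable pairs, which are
  the arrows of the line-extension (\<open>geometric_support_matrix_coalgebra\<close>). Coassociativity holds since both
  iterated coproducts of \<open>E (i, k)\<close> run through the composable triples from \<open>i\<close> to \<open>k\<close>
  (\<open>coproduct_rep_coassociative\<close>). The argument works over every field.

  Two facts about tensor powers, as quotients of spaces of formal combinations of lists, turn this computation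
  with explicit representatives into a statement on tensor classes. One is that the tensor product of linear maps
  can be computed on arbitrary representatives (\<open>tensor_map_eq\<close>), because concatenation with a tensor
  preserves the multilinearity relations. The other is that the coefficients with respect to a basis are well-defined
  (\<open>appears_in_tensor_class_iff\<close>), because they are values of bilinear forms, which vanish on the relations.
\<close>

section \<open>Formal linear combinations\<close>

lemma formal_extend_superset:
  assumes "finite A" "Poly_Mapping.keys f \<subseteq> A"
  shows "formal_extend g f = (\<Sum>a\<in>A. formal_scale (Poly_Mapping.lookup f a) (g a))"
  unfolding formal_extend_def
  by (rule sum.mono_neutral_left) (use assms in \<open>auto simp: in_keys_iff\<close>)

global_interpretation extend: Vector_Spaces.linear formal_scale formal_scale
    "formal_extend g :: ('a \<Rightarrow>\<^sub>0 'k::field) \<Rightarrow> ('b \<Rightarrow>\<^sub>0 'k)" for g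
proof unfold_locales
  fix f f' :: "'a \<Rightarrow>\<^sub>0 'k"
  let ?A = "Poly_Mapping.keys f \<union> Poly_Mapping.keys f'"
  have "formal_extend g (f + f') =
      (\<Sum>a\<in>?A. formal_scale (Poly_Mapping.lookup (f + f') a) (g a))"
    using keys_add[of f f'] by (intro formal_extend_superset) auto
  also have "\<dots> = formal_extend g f + formal_extend g f'"
    by (simp add: formal_extend_superset[of ?A] lookup_add formal.scale_left_distrib sum.distrib)
  finally show "formal_extend g (f + f') = formal_extend g f + formal_extend g f'" .
next
  fix c :: 'k and f :: "'a \<Rightarrow>\<^sub>0 'k"
  have "Poly_Mapping.keys (formal_scale c f) \<subseteq> Poly_Mapping.keys f"
    by (auto simp: in_keys_iff)
  then show "formal_extend g (formal_scale c f) = formal_scale c (formal_extend g f)"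
    by (simp add: formal_extend_superset[of "Poly_Mapping.keys f"] formal.scale_sum_right)
qed

lemma formal_scale_single [simp]:
  "formal_scale c (Poly_Mapping.single a d) = Poly_Mapping.single a (c * d)"
  by (simp add: formal_scale_def)

lemma formal_extend_single [simp]:
  "formal_extend g (Poly_Mapping.single a c) = formal_scale c (g a)"
  by (subst formal_extend_superset[of "{a}"]) auto

lemma lookup_formal_extend:
  "Poly_Mapping.lookup (formal_extend g f) b =
    (\<Sum>a\<in>Poly_Mapping.keys f. Poly_Mapping.lookup f a * Poly_Mapping.lookup (g a) b)"
  by (simp add: formal_extend_def lookup_sum)

lemma formal_extend_in_subspace:
  assumes "formal.subspace S" "\<And>a. a \<in> Poly_Mapping.keys f \<Longrightarrow> g a \<in> S"
  shows "formal_extend g f \<in> S"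
  unfolding formal_extend_def
  using assms by (intro formal.subspace_sum formal.subspace_scale) auto

lemma formal_extend_diff_fun:
  "formal_extend (\<lambda>a. g a - h a) f = formal_extend g f - formal_extend h f"
  by (simp add: formal_extend_def formal.scale_right_diff_distrib sum_subtractf)

lemma formal_extend_swap:
  "formal_extend (\<lambda>a. formal_extend (h a) g) f =
    formal_extend (\<lambda>b. formal_extend (\<lambda>a. h a b) f) g"
  unfolding formal_extend_def
  by (simp add: formal.scale_sum_right mult.commute) (rule sum.swap)

lemma formal_extend_span:
  assumes "f \<in> formal.span R" "formal.subspace S" "\<And>r. r \<in> R \<Longrightarrow> formal_extend g r \<in> S"
  shows "formal_extend g f \<in> S"
  using formal.span_induct[OF assms(1) extend.subspace_linear_preimage[OF assms(2), unfolded mem_Collect_eq]]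
    assms(3) by auto

text \<open>Concatenation extends linearly in either argument first. The definition shows linearity on
  the left; this form shows it on the right.\<close>

lemma formal_concat_swap:
  "formal_concat f g =
    formal_extend (\<lambda>ys. formal_extend (\<lambda>xs. Poly_Mapping.single (xs @ ys) 1) f) g"
  unfolding formal_concat_def by (rule formal_extend_swap)

global_interpretation concat_left: Vector_Spaces.linear formal_scale formal_scale
    "\<lambda>f. formal_concat f g" for g
  unfolding formal_concat_def by (rule extend.linear_axioms)

global_interpretation concat_right: Vector_Spaces.linear formal_scale formal_scale
    "formal_concat f" for f
  unfolding formal_concat_swap by (rule extend.linear_axioms)

lemma formal_concat_single [simp]:
  "formal_concat (Poly_Mapping.single xs c) (Poly_Mapping.single ys d) =
    Poly_Mapping.single (xs @ ys) (c * d)"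
  by (simp add: formal_concat_def)

section \<open>Multilinearity relations\<close>

lemma subspace_formal_tensors:
  "formal.subspace (formal_tensors L m :: ('v list \<Rightarrow>\<^sub>0 'k::field) set)"
proof (rule formal.subspaceI)
  fix f g :: "'v list \<Rightarrow>\<^sub>0 'k"
  assume "f \<in> formal_tensors L m" "g \<in> formal_tensors L m"
  then show "f + g \<in> formal_tensors L m"
    using keys_add[of f g] unfolding formal_tensors_def by blast
qed (auto simp: formal_tensors_def in_keys_iff)

lemma single_in_formal_tensors:
  "length xs = m \<Longrightarrow> set xs \<subseteq> L \<Longrightarrow> Poly_Mapping.single xs c \<in> formal_tensors L m"
  by (simp add: formal_tensors_def)

lemma formal_concat_in_formal_tensors:
  assumes "f \<in> formal_tensors L a" "g \<in> formal_tensors L b"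
  shows "formal_concat f g \<in> formal_tensors L (a + b)"
  unfolding formal_concat_def using assms
  by (intro formal_extend_in_subspace subspace_formal_tensors single_in_formal_tensors)
    (auto simp: formal_tensors_def)

abbreviation relation_span ::
    "('k::field \<Rightarrow> 'v::ab_group_add \<Rightarrow> 'v) \<Rightarrow> 'v set \<Rightarrow> nat \<Rightarrow> ('v list \<Rightarrow>\<^sub>0 'k) set" where
  "relation_span scale L m \<equiv> formal.span (multilinear_relations scale L m)"

lemma additivity_relation:
  assumes "set xs \<union> {x, y} \<union> set ys \<subseteq> L" "length xs + 1 + length ys = m"
  shows "Poly_Mapping.single (xs @ [x + y] @ ys) 1
        - Poly_Mapping.single (xs @ [x] @ ys) 1 - Poly_Mapping.single (xs @ [y] @ ys) 1
      \<in> relation_span scale L m"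
  by (rule formal.span_base, unfold multilinear_relations_def, rule UnI1) (use assms in blast)

lemma homogeneity_relation:
  assumes "set xs \<union> {x} \<union> set ys \<subseteq> L" "length xs + 1 + length ys = m"
  shows "Poly_Mapping.single (xs @ [scale c x] @ ys) 1
        - formal_scale c (Poly_Mapping.single (xs @ [x] @ ys) 1) \<in> relation_span scale L m"
  by (rule formal.span_base, unfold multilinear_relations_def, rule UnI2) (use assms in blast)

lemma multilinear_relations_cases:
  assumes "r \<in> multilinear_relations scale L m"
  obtains (add) xs x y ys where
      "r = Poly_Mapping.single (xs @ [x + y] @ ys) 1
        - Poly_Mapping.single (xs @ [x] @ ys) 1 - Poly_Mapping.single (xs @ [y] @ ys) 1"
      "set xs \<union> {x, y} \<union> set ys \<subseteq> L" "length xs + 1 + length ys = m"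
  | (scale) xs c x ys where
      "r = Poly_Mapping.single (xs @ [scale c x] @ ys) 1
        - formal_scale c (Poly_Mapping.single (xs @ [x] @ ys) 1)"
      "set xs \<union> {x} \<union> set ys \<subseteq> L" "length xs + 1 + length ys = m"
  using assms unfolding multilinear_relations_def by blast

text \<open>A relation remains a relation when each of its lists is lengthened by the same list: the
  additional entries join the unchanged entries around the slot in which the relation lives.
  So the relations are closed under concatenation with arbitrary tensors, on either side, which
  is what makes the product of two tensor classes well-defined.\<close>

lemma formal_concat_relation_left:
  assumes f: "f \<in> relation_span scale L a" and g: "g \<in> formal_tensors L b"
  shows "formal_concat f g \<in> relation_span scale L (a + b)"
  unfolding formal_concat_swap
proof (rule formal_extend_in_subspace[OF formal.subspace_span],
    rule formal_extend_span[OF f formal.subspace_span])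
  fix ys r assume "ys \<in> Poly_Mapping.keys g" and r: "r \<in> multilinear_relations scale L a"
  with g have ys: "set ys \<subseteq> L" "length ys = b"
    by (auto simp: formal_tensors_def)
  from r show "formal_extend (\<lambda>xs. Poly_Mapping.single (xs @ ys) 1) r \<in> relation_span scale L (a + b)"
  proof (cases rule: multilinear_relations_cases)
    case (add us x y vs)
    then show ?thesis
      using additivity_relation[of us x y "vs @ ys" L "a + b" scale] ys by (simp add: extend.diff)
  next
    case (scale us c x vs)
    then show ?thesis
      using homogeneity_relation[of us x "vs @ ys" L "a + b" scale c] ys by (simp add: extend.diff)
  qed
qed

lemma formal_concat_relation_right:
  assumes f: "f \<in> formal_tensors L a" and g: "g \<in> relation_span scale L b"
  shows "formal_concat f g \<in> relation_span scale L (a + b)"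
  unfolding formal_concat_def
proof (rule formal_extend_in_subspace[OF formal.subspace_span],
    rule formal_extend_span[OF g formal.subspace_span])
  fix xs r assume "xs \<in> Poly_Mapping.keys f" and r: "r \<in> multilinear_relations scale L b"
  with f have xs: "set xs \<subseteq> L" "length xs = a"
    by (auto simp: formal_tensors_def)
  from r show "formal_extend (\<lambda>ys. Poly_Mapping.single (xs @ ys) 1) r \<in> relation_span scale L (a + b)"
  proof (cases rule: multilinear_relations_cases)
    case (add us x y vs)
    then show ?thesis
      using additivity_relation[of "xs @ us" x y vs L "a + b" scale] xs by (simp add: extend.diff)
  next
    case (scale us c x vs)
    then show ?thesis
      using homogeneity_relation[of "xs @ us" x vs L "a + b" scale c] xs by (simp add: extend.diff)
  qed
qed

text \<open>The telescoping \<open>f g - f' g' = (f - f') g + f' (g - g')\<close> treats one factor at a time.\<close>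

lemma formal_concat_congruence:
  assumes "f - f' \<in> relation_span scale L a" "g - g' \<in> relation_span scale L b"
    and "f' \<in> formal_tensors L a" "g \<in> formal_tensors L b"
  shows "formal_concat f g - formal_concat f' g' \<in> relation_span scale L (a + b)"
proof -
  have "formal_concat f g - formal_concat f' g' =
      formal_concat (f - f') g + formal_concat f' (g - g')"
    by (simp add: concat_left.diff concat_right.diff)
  then show ?thesis
    using assms
    by (simp add: formal.span_add formal_concat_relation_left formal_concat_relation_right)
qed

section \<open>Tensor classes\<close>

lemma in_tensor_class_iff:
  assumes "f \<in> formal_tensors L m"
  shows "g \<in> tensor_class scale L m f \<longleftrightarrow>
    g \<in> formal_tensors L m \<and> f - g \<in> relation_span scale L m"
  using assms by (auto simp: tensor_class_def tensor_eq_def)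

lemma equiv_tensor_eq: "equiv (formal_tensors L m) (tensor_eq scale L m)"
proof (rule equivI)
  show "tensor_eq scale L m \<subseteq> formal_tensors L m \<times> formal_tensors L m"
    by (auto simp: tensor_eq_def)
  show "refl_on (formal_tensors L m) (tensor_eq scale L m)"
    by (auto simp: refl_on_def tensor_eq_def formal.span_zero)
  show "sym (tensor_eq scale L m)"
    by (rule symI, simp add: tensor_eq_def) (metis formal.span_neg minus_diff_eq)
  show "trans (tensor_eq scale L m)"
  proof (rule transI)
    fix f g h assume "(f, g) \<in> tensor_eq scale L m" "(g, h) \<in> tensor_eq scale L m"
    then show "(f, h) \<in> tensor_eq scale L m"
      using formal.span_add[of "f - g" "multilinear_relations scale L m" "g - h"]
      by (simp add: tensor_eq_def)
  qed
qed

lemma tensor_class_eq_iff: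
  assumes "f \<in> formal_tensors L m" "g \<in> formal_tensors L m"
  shows "tensor_class scale L m f = tensor_class scale L m g \<longleftrightarrow>
    f - g \<in> relation_span scale L m"
proof -
  have "tensor_class scale L m f = tensor_class scale L m g \<longleftrightarrow> (f, g) \<in> tensor_eq scale L m"
    unfolding tensor_class_def by (rule eq_equiv_class_iff[OF equiv_tensor_eq assms])
  also have "\<dots> \<longleftrightarrow> f - g \<in> relation_span scale L m"
    using assms by (simp add: tensor_eq_def)
  finally show ?thesis .
qed

lemma tensor_class_in_tensor_power:
  "f \<in> formal_tensors L m \<Longrightarrow> tensor_class scale L m f \<in> tensor_power scale L m"
  unfolding tensor_class_def tensor_power_def by (rule quotientI)

lemma tensor_rep_in:
  assumes "A \<in> tensor_power scale L m"
  shows "tensor_rep A \<in> A"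
  using in_quotient_imp_non_empty[OF equiv_tensor_eq assms[unfolded tensor_power_def]]
  unfolding tensor_rep_def by (simp add: some_in_eq)

lemma tensor_power_subset:
  "A \<in> tensor_power scale L m \<Longrightarrow> A \<subseteq> formal_tensors L m"
  unfolding tensor_power_def by (rule in_quotient_imp_subset[OF equiv_tensor_eq])

lemma tensor_power_diff:
  assumes "A \<in> tensor_power scale L m" "f \<in> A" "g \<in> A"
  shows "f - g \<in> relation_span scale L m"
proof -
  have "(f, g) \<in> tensor_eq scale L m"
    using assms unfolding tensor_power_def
    by (intro in_quotient_imp_in_rel[OF equiv_tensor_eq]) auto
  then show ?thesis
    by (simp add: tensor_eq_def)
qed

text \<open>Any element of a class can serve as its representative. This frees computations from the
  choice made by \<open>tensor_rep\<close>, of which only the membership in the class is known.\<close>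

lemma tensor_power_eq_tensor_class:
  assumes A: "A \<in> tensor_power scale L m" and f: "f \<in> A"
  shows "A = tensor_class scale L m f"
proof (rule set_eqI)
  fix g
  have T: "f \<in> formal_tensors L m"
    using tensor_power_subset[OF A] f by auto
  show "g \<in> A \<longleftrightarrow> g \<in> tensor_class scale L m f"
  proof
    assume "g \<in> A"
    then show "g \<in> tensor_class scale L m f"
      using tensor_power_subset[OF A] tensor_power_diff[OF A f] by (auto simp: in_tensor_class_iff[OF T])
  next
    assume "g \<in> tensor_class scale L m f"
    then have "(f, g) \<in> tensor_eq scale L m"
      by (simp add: tensor_class_def)
    then show "g \<in> A"
      using in_quotient_imp_closed[OF equiv_tensor_eq] A f unfolding tensor_power_def by blast
  qed
qed

lemma tensor_class_self:
  "f \<in> formal_tensors L m \<Longrightarrow> f \<in> tensor_class scale L m f"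
  by (simp add: in_tensor_class_iff formal.span_zero)

lemma tensor_add_eq:
  assumes A: "A \<in> tensor_power scale L m" "f \<in> A" and B: "B \<in> tensor_power scale L m" "g \<in> B"
  shows "tensor_add scale L m A B = tensor_class scale L m (f + g)"
proof -
  have "tensor_rep A - f \<in> relation_span scale L m" "tensor_rep B - g \<in> relation_span scale L m"
    using tensor_power_diff[OF A(1) tensor_rep_in[OF A(1)] A(2)]
      tensor_power_diff[OF B(1) tensor_rep_in[OF B(1)] B(2)] by simp_all
  from formal.span_add[OF this]
  have "(tensor_rep A + tensor_rep B) - (f + g) \<in> relation_span scale L m"
    by (simp add: algebra_simps)
  moreover have "tensor_rep A \<in> formal_tensors L m" "f \<in> formal_tensors L m"
      "tensor_rep B \<in> formal_tensors L m" "g \<in> formal_tensors L m"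
    using tensor_power_subset[OF A(1)] tensor_power_subset[OF B(1)]
      tensor_rep_in[OF A(1)] tensor_rep_in[OF B(1)] A(2) B(2) by auto
  ultimately show ?thesis
    unfolding tensor_add_def
    by (subst tensor_class_eq_iff) (auto intro: formal.subspace_add[OF subspace_formal_tensors])
qed

lemma tensor_scale_eq:
  assumes A: "A \<in> tensor_power scale L m" "f \<in> A"
  shows "tensor_scale scale L m c A = tensor_class scale L m (formal_scale c f)"
proof -
  have "formal_scale c (tensor_rep A - f) \<in> relation_span scale L m"
    using tensor_power_diff[OF A(1) tensor_rep_in[OF A(1)] A(2)] by (rule formal.span_scale)
  moreover have "tensor_rep A \<in> formal_tensors L m" "f \<in> formal_tensors L m"
    using tensor_power_subset[OF A(1)] tensor_rep_in[OF A(1)] A(2) by auto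
  ultimately show ?thesis
    unfolding tensor_scale_def
    by (subst tensor_class_eq_iff)
      (auto simp: formal.scale_right_diff_distrib
        intro: formal.subspace_scale[OF subspace_formal_tensors])
qed

section \<open>Linear maps into tensor powers\<close>

lemma (in vector_space) linear_to_tensor_power_classI:
  assumes L: "subspace L"
    and tensor: "\<And>x. x \<in> L \<Longrightarrow> p x \<in> formal_tensors L m"
    and add: "\<And>x y. x \<in> L \<Longrightarrow> y \<in> L \<Longrightarrow> p (x + y) - (p x + p y) \<in> relation_span scale L m"
    and scale: "\<And>c x. x \<in> L \<Longrightarrow> p (scale c x) - formal_scale c (p x) \<in> relation_span scale L m"
  shows "linear_to_tensor_power scale L m (\<lambda>x. tensor_class scale L m (p x))"
proof -
  have *: "tensor_class scale L m (p x) \<in> tensor_power scale L m"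
      "p x \<in> tensor_class scale L m (p x)" if "x \<in> L" for x
    using tensor[OF that] by (simp_all add: tensor_class_in_tensor_power tensor_class_self)
  show ?thesis
    unfolding linear_to_tensor_power_def
  proof (intro conjI ballI allI)
    fix x y assume "x \<in> L" "y \<in> L"
    then show "tensor_class scale L m (p (x + y)) =
        tensor_add scale L m (tensor_class scale L m (p x)) (tensor_class scale L m (p y))"
      using L add
      by (simp add: tensor_add_eq[OF * *] tensor_class_eq_iff tensor subspace_add
          formal.subspace_add[OF subspace_formal_tensors])
  next
    fix c x assume "x \<in> L"
    then show "tensor_class scale L m (p (scale c x)) =
        tensor_scale scale L m c (tensor_class scale L m (p x))"
      using L scale
      by (simp add: tensor_scale_eq[OF *] tensor_class_eq_iff tensor subspace_scale
          formal.subspace_scale[OF subspace_formal_tensors])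
  qed (use * in auto)
qed

lemma (in vector_space) linear_tensor_id:
  assumes "subspace L"
  shows "linear_to_tensor_power scale L 1 (tensor_id scale L)"
  unfolding tensor_id_def
proof (rule linear_to_tensor_power_classI[OF assms])
  fix x y assume "x \<in> L" "y \<in> L"
  then show "Poly_Mapping.single [x + y] 1 -
      (Poly_Mapping.single [x] 1 + Poly_Mapping.single [y] 1) \<in> relation_span scale L 1"
    using additivity_relation[of "[]" x y "[]" L 1 scale] by (simp add: diff_diff_eq)
next
  fix c x assume "x \<in> L"
  then show "Poly_Mapping.single [scale c x] 1 -
      formal_scale c (Poly_Mapping.single [x] 1) \<in> relation_span scale L 1"
    using homogeneity_relation[of "[]" x "[]" L 1 scale c] by simp
qed (simp add: single_in_formal_tensors)

text \<open>Representatives picked separately for the values of a linear map need not depend linearly on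
  the argument; they do so only modulo the relations.\<close>

lemma (in vector_space) representatives_linear:
  assumes \<phi>: "linear_to_tensor_power scale L m \<phi>" and L: "subspace L"
    and p: "\<And>x. x \<in> L \<Longrightarrow> p x \<in> \<phi> x"
  shows "\<And>x y. x \<in> L \<Longrightarrow> y \<in> L \<Longrightarrow> p (x + y) - (p x + p y) \<in> relation_span scale L m"
    and "\<And>c x. x \<in> L \<Longrightarrow> p (scale c x) - formal_scale c (p x) \<in> relation_span scale L m"
proof -
  have power: "\<phi> x \<in> tensor_power scale L m" if "x \<in> L" for x
    using \<phi> that by (simp add: linear_to_tensor_power_def)
  have tensor: "p x \<in> formal_tensors L m" if "x \<in> L" for x
    using tensor_power_subset[OF power[OF that]] p[OF that] by auto
  show "p (x + y) - (p x + p y) \<in> relation_span scale L m" if "x \<in> L" "y \<in> L" for x y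
  proof -
    have xy: "x + y \<in> L"
      using L that by (rule subspace_add)
    have "tensor_class scale L m (p (x + y)) = tensor_add scale L m (\<phi> x) (\<phi> y)"
      using \<phi> that tensor_power_eq_tensor_class[OF power[OF xy] p[OF xy]]
      by (simp add: linear_to_tensor_power_def)
    also have "\<dots> = tensor_class scale L m (p x + p y)"
      using that by (intro tensor_add_eq power p)
    finally show ?thesis
      using that xy by (simp add: tensor_class_eq_iff tensor formal.subspace_add[OF subspace_formal_tensors])
  qed
  show "p (scale c x) - formal_scale c (p x) \<in> relation_span scale L m" if "x \<in> L" for c x
  proof -
    have cx: "scale c x \<in> L"
      using L that by (rule subspace_scale)
    have "tensor_class scale L m (p (scale c x)) = tensor_scale scale L m c (\<phi> x)"
      using \<phi> that tensor_power_eq_tensor_class[OF power[OF cx] p[OF cx]]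
      by (simp add: linear_to_tensor_power_def)
    also have "\<dots> = tensor_class scale L m (formal_scale c (p x))"
      using that by (intro tensor_scale_eq power p)
    finally show ?thesis
      using that cx by (simp add: tensor_class_eq_iff tensor formal.subspace_scale[OF subspace_formal_tensors])
  qed
qed

text \<open>The universal property of the tensor square, modulo a subspace \<open>S\<close>. It is used with \<open>S\<close> the
  span of the relations of another degree, where the values of \<open>B\<close> are bilinear only up to
  relations, and with \<open>S\<close> the zero subspace, for scalar bilinear forms.\<close>

lemma (in vector_space) bilinear_extension_relation:
  assumes r: "r \<in> relation_span scale L 2"
    and add_left: "\<And>x y z. x \<in> L \<Longrightarrow> y \<in> L \<Longrightarrow> z \<in> L \<Longrightarrow>
      B [x + y, z] - (B [x, z] + B [y, z]) \<in> S"
    and scale_left: "\<And>c x z. x \<in> L \<Longrightarrow> z \<in> L \<Longrightarrow>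
      B [scale c x, z] - formal_scale c (B [x, z]) \<in> S"
    and add_right: "\<And>x y z. x \<in> L \<Longrightarrow> y \<in> L \<Longrightarrow> z \<in> L \<Longrightarrow>
      B [z, x + y] - (B [z, x] + B [z, y]) \<in> S"
    and scale_right: "\<And>c x z. x \<in> L \<Longrightarrow> z \<in> L \<Longrightarrow>
      B [z, scale c x] - formal_scale c (B [z, x]) \<in> S"
    and S: "formal.subspace S"
  shows "formal_extend B r \<in> S"
proof (rule formal_extend_span[OF r S])
  have split: "(\<exists>z. us = [] \<and> vs = [z]) \<or> (\<exists>z. us = [z] \<and> vs = [])"
    if "length us + 1 + length vs = 2" for us vs :: "'b list"
    using that by (cases us; cases vs) auto
  fix r assume "r \<in> multilinear_relations scale L 2"
  then show "formal_extend B r \<in> S"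
  proof (cases rule: multilinear_relations_cases)
    case (add us x y vs)
    from split[OF add(3)] show ?thesis
      using add(1,2) add_left[of x y] add_right[of x y]
      by (auto simp: extend.diff extend.add diff_diff_eq)
  next
    case (scale us c x vs)
    from split[OF scale(3)] show ?thesis
      using scale(1,2) scale_left[of x] scale_right[of x] by (auto simp: extend.diff)
  qed
qed

text \<open>The tensor product of two linear maps may be computed with any representatives of their values
  and of the argument. Two changes of choice are involved. Passing from \<open>f\<close> to another
  representative changes the result by the image of a relation, which is again in the span of the
  relations by bilinearity. Changing the representatives of the values changes each summand by
  a relation.\<close>

lemma (in vector_space) tensor_map_eq:
  assumes L: "subspace L"
    and \<phi>: "linear_to_tensor_power scale L a \<phi>" and p: "\<And>x. x \<in> L \<Longrightarrow> p x \<in> \<phi> x"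
    and \<psi>: "linear_to_tensor_power scale L b \<psi>" and q: "\<And>x. x \<in> L \<Longrightarrow> q x \<in> \<psi> x"
    and f: "f \<in> formal_tensors L 2"
  shows "tensor_map scale L (a + b) \<phi> \<psi> (tensor_class scale L 2 f) =
    tensor_class scale L (a + b) (formal_extend (\<lambda>l. formal_concat (p (l ! 0)) (q (l ! 1))) f)"
proof -
  define P where "P x = tensor_rep (\<phi> x)" for x
  define Q where "Q x = tensor_rep (\<psi> x)" for x
  define f' where "f' = tensor_rep (tensor_class scale L 2 f)"
  let ?R = "relation_span scale L (a + b)"
  let ?B = "\<lambda>P Q l. formal_concat (P (l ! 0)) (Q (l ! 1))"
  have \<phi>_power: "\<phi> x \<in> tensor_power scale L a" if "x \<in> L" for x
    using \<phi> that by (simp add: linear_to_tensor_power_def)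
  have \<psi>_power: "\<psi> x \<in> tensor_power scale L b" if "x \<in> L" for x
    using \<psi> that by (simp add: linear_to_tensor_power_def)
  have P: "P x \<in> \<phi> x" and Q: "Q x \<in> \<psi> x" if "x \<in> L" for x
    using that by (simp_all add: P_def Q_def tensor_rep_in[OF \<phi>_power] tensor_rep_in[OF \<psi>_power])
  have \<phi>_tensor: "g \<in> formal_tensors L a" if "g \<in> \<phi> x" "x \<in> L" for g x
    using tensor_power_subset[OF \<phi>_power[OF that(2)]] that(1) by auto
  have \<psi>_tensor: "g \<in> formal_tensors L b" if "g \<in> \<psi> x" "x \<in> L" for g x
    using tensor_power_subset[OF \<psi>_power[OF that(2)]] that(1) by auto
  note tensors = \<phi>_tensor[OF P] \<psi>_tensor[OF Q] \<phi>_tensor[OF p] \<psi>_tensor[OF q]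
  have f': "f' \<in> tensor_class scale L 2 f"
    unfolding f'_def by (rule tensor_rep_in[OF tensor_class_in_tensor_power[OF f]])
  then have f'_tensor: "f' \<in> formal_tensors L 2" and diff: "f - f' \<in> relation_span scale L 2"
    by (simp_all add: in_tensor_class_iff[OF f])
  have "formal_extend (?B P Q) (f - f') \<in> ?R"
  proof (rule bilinear_extension_relation[OF diff])
    show "?B P Q [x + y, z] - (?B P Q [x, z] + ?B P Q [y, z]) \<in> ?R"
      if "x \<in> L" "y \<in> L" "z \<in> L" for x y z
      using formal_concat_relation_left[OF representatives_linear(1)[OF \<phi> L P, of x y] tensors(2)[of z]] that
      by (simp add: concat_left.diff concat_left.add)
    show "?B P Q [scale c x, z] - formal_scale c (?B P Q [x, z]) \<in> ?R"
      if "x \<in> L" "z \<in> L" for c x z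
      using formal_concat_relation_left[OF representatives_linear(2)[OF \<phi> L P, of x c] tensors(2)[of z]] that
      by (simp add: concat_left.diff concat_left.scale)
    show "?B P Q [z, x + y] - (?B P Q [z, x] + ?B P Q [z, y]) \<in> ?R"
      if "x \<in> L" "y \<in> L" "z \<in> L" for x y z
      using formal_concat_relation_right[OF tensors(1)[of z] representatives_linear(1)[OF \<psi> L Q, of x y]] that
      by (simp add: concat_right.diff concat_right.add)
    show "?B P Q [z, scale c x] - formal_scale c (?B P Q [z, x]) \<in> ?R"
      if "x \<in> L" "z \<in> L" for c x z
      using formal_concat_relation_right[OF tensors(1)[of z] representatives_linear(2)[OF \<psi> L Q, of x c]] that
      by (simp add: concat_right.diff concat_right.scale)
  qed auto
  moreover have "formal_extend (\<lambda>l. ?B P Q l - ?B p q l) f \<in> ?R"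
  proof (rule formal_extend_in_subspace[OF formal.subspace_span])
    fix l assume "l \<in> Poly_Mapping.keys f"
    with f have l: "l ! 0 \<in> L" "l ! 1 \<in> L"
      by (auto simp: formal_tensors_def subset_iff)
    show "?B P Q l - ?B p q l \<in> ?R"
      using l by (intro formal_concat_congruence tensors
          tensor_power_diff[OF \<phi>_power P p] tensor_power_diff[OF \<psi>_power Q q])
  qed
  ultimately have "formal_extend (\<lambda>l. ?B P Q l - ?B p q l) f - formal_extend (?B P Q) (f - f') \<in> ?R"
    by (intro formal.span_diff)
  then have "formal_extend (?B P Q) f' - formal_extend (?B p q) f \<in> ?R"
    by (simp add: formal_extend_diff_fun extend.diff)
  moreover have "formal_extend (?B P Q) f' \<in> formal_tensors L (a + b)"
    using f'_tensor
    by (intro formal_extend_in_subspace[OF subspace_formal_tensors] formal_concat_in_formal_tensors tensors)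
      (auto simp: formal_tensors_def subset_iff)
  moreover have "formal_extend (?B p q) f \<in> formal_tensors L (a + b)"
    using f
    by (intro formal_extend_in_subspace[OF subspace_formal_tensors] formal_concat_in_formal_tensors tensors)
      (auto simp: formal_tensors_def subset_iff)
  ultimately show ?thesis
    unfolding tensor_map_def by (subst tensor_class_eq_iff) (simp_all add: P_def Q_def f'_def)
qed

section \<open>Coefficients of a tensor of degree two\<close>

text \<open>The coefficient of \<open>u \<otimes> v\<close> does not depend on the representative: the product of the
  \<open>u\<close>-coordinate of the first factor and the \<open>v\<close>-coordinate of the second one is a bilinear form,
  hence a linear form on the tensor square, and on combinations of pairs of basis elements it reads
  off the coefficient of \<open>[u, v]\<close>.\<close>

lemma (in vector_space) appears_in_tensor_class_iff:
  assumes B: "basis_of B L" and uv: "u \<in> B" "v \<in> B"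
    and f: "Poly_Mapping.keys f \<subseteq> {[a, b] | a b. a \<in> B \<and> b \<in> B}"
  shows "appears_in B u v (tensor_class scale L 2 f) \<longleftrightarrow> Poly_Mapping.lookup f [u, v] \<noteq> 0"
proof -
  have BL: "B \<subseteq> L" and indep: "independent B" and span: "span B = L"
    using B by (auto simp: basis_of_def)
  have f_tensor: "f \<in> formal_tensors L 2"
    using f BL by (fastforce simp: formal_tensors_def)
  \<comment> \<open>The scalars are the combinations of a single generator, so that the bilinear form is
    extended to formal tensors by \<open>formal_extend\<close>.\<close>
  define coord :: "'b list \<Rightarrow> unit \<Rightarrow>\<^sub>0 'a" where "coord l =
    Poly_Mapping.single () (representation B (l ! 0) u * representation B (l ! 1) v)" for l
  have coord_eq: "Poly_Mapping.lookup (formal_extend coord g) () = Poly_Mapping.lookup g [u, v]"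
    if g: "Poly_Mapping.keys g \<subseteq> {[a, b] | a b. a \<in> B \<and> b \<in> B}" for g :: "'b list \<Rightarrow>\<^sub>0 'a"
  proof -
    have "Poly_Mapping.lookup (coord l) () = (if l = [u, v] then 1 else 0)"
      if l: "l \<in> Poly_Mapping.keys g" for l
    proof -
      from g l obtain a b where "l = [a, b]" "a \<in> B" "b \<in> B"
        by blast
      then show ?thesis
        by (simp add: coord_def representation_basis[OF indep])
    qed
    then have "Poly_Mapping.lookup (formal_extend coord g) () =
        (\<Sum>l\<in>Poly_Mapping.keys g. if l = [u, v] then Poly_Mapping.lookup g l else 0)"
      unfolding lookup_formal_extend by (intro sum.cong) auto
    then show ?thesis
      by (simp add: sum.delta in_keys_iff)
  qed
  have coord_relation: "formal_extend coord r = 0" if "r \<in> relation_span scale L 2" for r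
  proof -
    have "formal_extend coord r \<in> {0}"
      using that
      by (rule bilinear_extension_relation)
        (simp_all add: coord_def span representation_add[OF indep] representation_scale[OF indep]
          algebra_simps flip: single_add)
    then show ?thesis by simp
  qed
  show ?thesis
  proof
    assume "appears_in B u v (tensor_class scale L 2 f)"
    then obtain g where g: "g \<in> tensor_class scale L 2 f" "Poly_Mapping.lookup g [u, v] \<noteq> 0"
      and keys: "Poly_Mapping.keys g \<subseteq> {[a, b] | a b. a \<in> B \<and> b \<in> B}"
      unfolding appears_in_def by blast
    have "formal_extend coord f = formal_extend coord g"
      using coord_relation[of "f - g"] g(1)
      by (simp add: in_tensor_class_iff[OF f_tensor] extend.diff)
    then show "Poly_Mapping.lookup f [u, v] \<noteq> 0"
      using g(2) coord_eq[OF f] coord_eq[OF keys] by simp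
  next
    assume "Poly_Mapping.lookup f [u, v] \<noteq> 0"
    then show "appears_in B u v (tensor_class scale L 2 f)"
      using f tensor_class_self[OF f_tensor] unfolding appears_in_def by blast
  qed
qed

section \<open>The matrix coalgebra\<close>

text \<open>The matrix unit \<open>E (i, j)\<close>, where the pairs of indices are numbered so that the generators are natural
  numbers for every size \<open>n\<close>.\<close>

definition matrix_unit :: "nat \<times> nat \<Rightarrow> (nat \<Rightarrow>\<^sub>0 'k::field)" where
  "matrix_unit p = Poly_Mapping.single (prod_encode p) 1"

definition matrix_units :: "nat \<Rightarrow> (nat \<Rightarrow>\<^sub>0 'k::field) set" where
  "matrix_units n = matrix_unit ` ({..<n} \<times> {..<n})"

definition matrix_space :: "nat \<Rightarrow> (nat \<Rightarrow>\<^sub>0 'k::field) set" where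
  "matrix_space n = formal.span (matrix_units n)"

text \<open>The linear extension of \<open>E (i, k) \<mapsto> \<Sum>j. E (i, j) \<otimes> E (j, k)\<close>, the dual of matrix
  multiplication. Reading the coefficients with \<open>lookup\<close> makes it linear on the nose and
  not only modulo the relations.\<close>

definition coproduct_rep :: "nat \<Rightarrow> (nat \<Rightarrow>\<^sub>0 'k::field) \<Rightarrow> ((nat \<Rightarrow>\<^sub>0 'k) list \<Rightarrow>\<^sub>0 'k)" where
  "coproduct_rep n x = (\<Sum>i<n. \<Sum>k<n. \<Sum>j<n.
     Poly_Mapping.single [matrix_unit (i, j), matrix_unit (j, k)]
       (Poly_Mapping.lookup x (prod_encode (i, k))))"

definition matrix_coproduct ::
    "nat \<Rightarrow> (nat \<Rightarrow>\<^sub>0 'k::field) \<Rightarrow> ((nat \<Rightarrow>\<^sub>0 'k) list \<Rightarrow>\<^sub>0 'k) set" where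
  "matrix_coproduct n x = tensor_class formal_scale (matrix_space n) 2 (coproduct_rep n x)"

lemma lookup_matrix_unit:
  "Poly_Mapping.lookup (matrix_unit p) (prod_encode q) = (if p = q then 1 else 0)"
  by (simp add: matrix_unit_def lookup_single when_def)

lemma inj_matrix_unit: "inj (matrix_unit :: _ \<Rightarrow> nat \<Rightarrow>\<^sub>0 'k::field)"
proof (rule injI)
  fix p q assume "matrix_unit p = (matrix_unit q :: nat \<Rightarrow>\<^sub>0 'k)"
  then have "Poly_Mapping.lookup (matrix_unit p :: nat \<Rightarrow>\<^sub>0 'k) (prod_encode q) = 1"
    by (simp add: lookup_matrix_unit)
  then show "p = q"
    by (simp add: lookup_matrix_unit split: if_splits)
qed

lemma matrix_unit_eq_iff [simp]:
  "matrix_unit p = (matrix_unit q :: nat \<Rightarrow>\<^sub>0 'k::field) \<longleftrightarrow> p = q"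
  by (rule inj_eq[OF inj_matrix_unit])

lemma matrix_unit_in [simp]: "i < n \<Longrightarrow> j < n \<Longrightarrow> matrix_unit (i, j) \<in> matrix_units n"
  by (simp add: matrix_units_def)

lemma matrix_units_subset: "matrix_units n \<subseteq> matrix_space n"
  unfolding matrix_space_def by (rule formal.span_superset)

lemma matrix_unit_in_space: "i < n \<Longrightarrow> j < n \<Longrightarrow> matrix_unit (i, j) \<in> matrix_space n"
  by (rule subsetD[OF matrix_units_subset matrix_unit_in])

lemma independent_matrix_units: "formal.independent (matrix_units n :: (nat \<Rightarrow>\<^sub>0 'k::field) set)"
  unfolding formal.independent_explicit_module
proof (intro allI impI)
  fix t :: "(nat \<Rightarrow>\<^sub>0 'k) set" and c w
  assume t: "finite t" "t \<subseteq> matrix_units n" and zero: "(\<Sum>v\<in>t. formal_scale (c v) v) = 0"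
    and w: "w \<in> t"
  from t w obtain p where p: "w = matrix_unit p"
    by (auto simp: matrix_units_def)
  have "c v * Poly_Mapping.lookup v (prod_encode p) = (if v = w then c v else 0)" if "v \<in> t" for v
    using t that p by (auto simp: matrix_units_def lookup_matrix_unit)
  then have "(\<Sum>v\<in>t. c v * Poly_Mapping.lookup v (prod_encode p)) = c w"
    using t w by (simp add: sum.delta)
  moreover have "(\<Sum>v\<in>t. c v * Poly_Mapping.lookup v (prod_encode p)) = 0"
    using arg_cong[OF zero, of "\<lambda>f. Poly_Mapping.lookup f (prod_encode p)"] by (simp add: lookup_sum)
  ultimately show "c w = 0"
    by simp
qed

lemma basis_of_matrix_space: "formal.basis_of (matrix_units n) (matrix_space n)"
  by (simp add: formal.basis_of_def matrix_units_subset independent_matrix_units)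
    (simp add: matrix_space_def)

lemma coproduct_rep_add: "coproduct_rep n (x + y) = coproduct_rep n x + coproduct_rep n y"
  by (simp add: coproduct_rep_def lookup_add single_add sum.distrib)

lemma coproduct_rep_scale: "coproduct_rep n (formal_scale c x) = formal_scale c (coproduct_rep n x)"
  by (simp add: coproduct_rep_def formal.scale_sum_right)

lemma coproduct_rep_in_formal_tensors: "coproduct_rep n x \<in> formal_tensors (matrix_space n) 2"
  unfolding coproduct_rep_def
  by (intro formal.subspace_sum[OF subspace_formal_tensors] single_in_formal_tensors)
    (simp_all add: matrix_unit_in_space)

lemma coproduct_rep_matrix_unit:
  assumes "i < n" "k < n"
  shows "coproduct_rep n (matrix_unit (i, k)) =
    (\<Sum>j<n. Poly_Mapping.single [matrix_unit (i, j), matrix_unit (j, k)] 1)"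
proof -
  have "coproduct_rep n (matrix_unit (i, k)) = (\<Sum>i'<n. \<Sum>k'<n. if i' = i \<and> k' = k
      then \<Sum>j<n. Poly_Mapping.single [matrix_unit (i, j), matrix_unit (j, k)] 1 else 0)"
    unfolding coproduct_rep_def by (intro sum.cong refl) (auto simp: lookup_matrix_unit)
  also have "\<dots> = (\<Sum>i'<n. if i' = i
      then \<Sum>j<n. Poly_Mapping.single [matrix_unit (i, j), matrix_unit (j, k)] 1 else 0)"
    using assms by (intro sum.cong refl) (auto simp: sum.delta)
  finally show ?thesis
    using assms by (simp add: sum.delta)
qed

lemma formal_extend_coproduct_rep:
  "formal_extend g (coproduct_rep n x) = (\<Sum>i<n. \<Sum>k<n. \<Sum>j<n.
     formal_scale (Poly_Mapping.lookup x (prod_encode (i, k)))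
       (g [matrix_unit (i, j), matrix_unit (j, k)]))"
  by (simp add: coproduct_rep_def extend.sum)

text \<open>Both iterated coproducts of \<open>E (i, k)\<close> are the sum of \<open>E (i, j) \<otimes> E (j, l) \<otimes> E (l, k)\<close> over
  all \<open>j\<close> and \<open>l\<close>: they sum over all walks of length three from \<open>i\<close> to \<open>k\<close>, and differ in the intermediate
  vertex that is inserted first. As formal combinations they coincide even before the relations are divided out.\<close>

lemma coproduct_rep_coassociative:
  "formal_extend (\<lambda>l. formal_concat (coproduct_rep n (l ! 0)) (Poly_Mapping.single [l ! 1] 1))
     (coproduct_rep n x) =
   formal_extend (\<lambda>l. formal_concat (Poly_Mapping.single [l ! 0] 1) (coproduct_rep n (l ! 1)))
     (coproduct_rep n x)"
  unfolding formal_extend_coproduct_rep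
proof (rule sum.cong[OF refl], rule sum.cong[OF refl])
  fix i k assume "i \<in> {..<n}" "k \<in> {..<n}"
  then show "(\<Sum>j<n. formal_scale (Poly_Mapping.lookup x (prod_encode (i, k)))
      (formal_concat (coproduct_rep n ([matrix_unit (i, j), matrix_unit (j, k)] ! 0))
        (Poly_Mapping.single [[matrix_unit (i, j), matrix_unit (j, k)] ! 1] 1))) =
    (\<Sum>j<n. formal_scale (Poly_Mapping.lookup x (prod_encode (i, k)))
      (formal_concat (Poly_Mapping.single [[matrix_unit (i, j), matrix_unit (j, k)] ! 0] 1)
        (coproduct_rep n ([matrix_unit (i, j), matrix_unit (j, k)] ! 1))))"
    by (simp add: coproduct_rep_matrix_unit concat_left.sum concat_right.sum
        formal.scale_sum_right) (rule sum.swap)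
qed

lemma coassociative_matrix_coalgebra:
  "coassociative_coalgebra formal_scale (matrix_space n)
    (matrix_coproduct n :: (nat \<Rightarrow>\<^sub>0 'k::field) \<Rightarrow> _)"
proof unfold_locales
  let ?L = "matrix_space n :: (nat \<Rightarrow>\<^sub>0 'k) set"
  show L: "formal.subspace ?L"
    by (simp add: matrix_space_def)
  show linear: "linear_to_tensor_power formal_scale ?L 2 (matrix_coproduct n)"
    unfolding matrix_coproduct_def
    by (rule formal.linear_to_tensor_power_classI[OF L coproduct_rep_in_formal_tensors])
      (simp_all add: coproduct_rep_add coproduct_rep_scale formal.span_zero)
  have id: "linear_to_tensor_power formal_scale ?L 1 (tensor_id formal_scale ?L)"
    by (rule formal.linear_tensor_id[OF L])
  have rep: "coproduct_rep n x \<in> matrix_coproduct n x" for x :: "nat \<Rightarrow>\<^sub>0 'k"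
    unfolding matrix_coproduct_def by (rule tensor_class_self[OF coproduct_rep_in_formal_tensors])
  have id_rep: "Poly_Mapping.single [x] 1 \<in> tensor_id formal_scale ?L x" if "x \<in> ?L" for x
    unfolding tensor_id_def using that by (intro tensor_class_self single_in_formal_tensors) auto
  fix x assume "x \<in> ?L"
  have "tensor_map formal_scale ?L (2 + 1) (matrix_coproduct n) (tensor_id formal_scale ?L)
      (matrix_coproduct n x) =
    tensor_map formal_scale ?L (1 + 2) (tensor_id formal_scale ?L) (matrix_coproduct n)
      (matrix_coproduct n x)"
    using formal.tensor_map_eq[OF L linear rep id id_rep coproduct_rep_in_formal_tensors, of x]
      formal.tensor_map_eq[OF L id id_rep linear rep coproduct_rep_in_formal_tensors, of x]
    unfolding matrix_coproduct_def[of n x] coproduct_rep_coassociative by (simp add: numeral_3_eq_3)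
  then show "tensor_map formal_scale ?L 3 (matrix_coproduct n) (tensor_id formal_scale ?L)
      (matrix_coproduct n x) =
    tensor_map formal_scale ?L 3 (tensor_id formal_scale ?L) (matrix_coproduct n)
      (matrix_coproduct n x)"
    by (simp add: numeral_3_eq_3)
qed

lemma keys_coproduct_rep_matrix_unit:
  fixes n :: nat
  assumes "i < n" "k < n"
  shows "Poly_Mapping.keys (coproduct_rep n (matrix_unit (i, k) :: nat \<Rightarrow>\<^sub>0 'k::field)) =
    {[matrix_unit (i, j), matrix_unit (j, k)] | j. j < n}"
proof (rule set_eqI)
  fix l :: "(nat \<Rightarrow>\<^sub>0 'k) list"
  have lookup: "Poly_Mapping.lookup (coproduct_rep n (matrix_unit (i, k))) l =
      (\<Sum>j<n. 1 when [matrix_unit (i, j), matrix_unit (j, k)] = l)"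
    by (simp add: coproduct_rep_matrix_unit[OF assms] lookup_sum lookup_single)
  show "l \<in> Poly_Mapping.keys (coproduct_rep n (matrix_unit (i, k))) \<longleftrightarrow>
      l \<in> {[matrix_unit (i, j), matrix_unit (j, k)] | j. j < n}"
  proof (cases "\<exists>j<n. l = [matrix_unit (i, j), matrix_unit (j, k)]")
    case True
    then obtain j where j: "j < n" "l = [matrix_unit (i, j), matrix_unit (j, k)]"
      by blast
    have "(\<Sum>j'<n. 1 when [matrix_unit (i, j'), matrix_unit (j', k)] = l) =
        (\<Sum>j'<n. if j' = j then 1 else (0 :: 'k))"
      by (intro sum.cong refl) (simp add: j(2) when_def)
    with j(1) have "Poly_Mapping.lookup (coproduct_rep n (matrix_unit (i, k))) l = (1 :: 'k)"
      unfolding lookup by simp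
    with True show ?thesis
      by (auto simp: in_keys_iff)
  next
    case False
    then have "(\<Sum>j<n. 1 when [matrix_unit (i, j), matrix_unit (j, k)] = l) = (0 :: 'k)"
      by (intro sum.neutral) (auto simp: when_def)
    with False show ?thesis
      by (auto simp: in_keys_iff lookup)
  qed
qed

text \<open>Arrows other than those between composable matrix units are excluded because a pair of basis
  elements with coefficient zero in \<open>coproduct_rep\<close> has coefficient zero in every combination of such pairs
  that represents the coproduct.\<close>

lemma appears_in_matrix_coproduct_iff:
  assumes "i < n" "k < n" "u \<in> matrix_units n" "v \<in> matrix_units n"
  shows "appears_in (matrix_units n) u v (matrix_coproduct n (matrix_unit (i, k))) \<longleftrightarrow>
    (\<exists>j<n. u = matrix_unit (i, j) \<and> v = matrix_unit (j, k))"
proof -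
  note keys = keys_coproduct_rep_matrix_unit[OF assms(1,2)]
  have "Poly_Mapping.keys (coproduct_rep n (matrix_unit (i, k))) \<subseteq>
      {[a, b] | a b. a \<in> matrix_units n \<and> b \<in> matrix_units n}"
    unfolding keys using matrix_unit_in assms(1,2) by blast
  then have "appears_in (matrix_units n) u v (matrix_coproduct n (matrix_unit (i, k))) \<longleftrightarrow>
      [u, v] \<in> Poly_Mapping.keys (coproduct_rep n (matrix_unit (i, k)))"
    unfolding matrix_coproduct_def in_keys_iff
    by (rule formal.appears_in_tensor_class_iff[OF basis_of_matrix_space assms(3,4)])
  then show ?thesis
    unfolding keys by auto
qed

section \<open>The graph of the matrix coalgebra\<close>

lemma digraph_isoI:
  assumes f: "inj_on f (pverts H)" and wf: "parcs H \<subseteq> pverts H \<times> pverts H"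
    and verts: "pverts G = f ` pverts H" and arcs: "parcs G = map_prod f f ` parcs H"
  shows "digraph_iso (with_proj G) (with_proj H)"
\<comment> \<open>The injection goes from \<open>H\<close> to \<open>G\<close>, which avoids naming its inverse.\<close>
proof (rule digraph_iso_swap)
  show wf_H: "wf_digraph (with_proj H)"
    using wf by (auto simp: wf_digraph_def)
  let ?h = "\<lparr>iso_verts = f, iso_arcs = map_prod f f, iso_head = snd, iso_tail = fst\<rparr>"
  have "pre_digraph.digraph_isomorphism (with_proj H) ?h"
    using wf_H f inj_on_subset[OF map_prod_inj_on[OF f f] wf]
    by (simp add: pre_digraph.digraph_isomorphism_def)
  moreover have "with_proj G = app_iso ?h (with_proj H)"
    by (simp add: app_iso_def with_proj_def verts arcs)
  ultimately show "digraph_iso (with_proj H) (with_proj G)"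
    unfolding digraph_iso_def by blast
qed

text \<open>The pair \<open>(i, j)\<close>, an arrow of the De Bruijn graph, corresponds to \<open>E (i, j)\<close>. The coproduct of \<open>E (i, k)\<close>
  contributes the arrows of the line-extension that start at some \<open>(i, j)\<close> and end at \<open>(j, k)\<close>.\<close>

lemma geometric_support_matrix_coalgebra:
  "digraph_iso
    (with_proj (geometric_support (matrix_units n)
      (matrix_coproduct n :: (nat \<Rightarrow>\<^sub>0 'k::field) \<Rightarrow> _)))
    (with_proj (line_extension (de_bruijn_1 n)))"
proof (rule digraph_isoI)
  let ?E = "matrix_unit :: nat \<times> nat \<Rightarrow> (nat \<Rightarrow>\<^sub>0 'k)"
  let ?H = "line_extension (de_bruijn_1 n)"
  let ?G = "geometric_support (matrix_units n) (matrix_coproduct n :: (nat \<Rightarrow>\<^sub>0 'k) \<Rightarrow> _)"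
  show "inj_on ?E (pverts ?H)"
    using inj_matrix_unit by (rule inj_on_subset) simp
  show "parcs ?H \<subseteq> pverts ?H \<times> pverts ?H"
    by (auto simp: line_extension_def)
  show "pverts ?G = ?E ` pverts ?H"
    by (simp add: geometric_support_def line_extension_def de_bruijn_1_def matrix_units_def)
  have H: "parcs ?H = {((i, j), (j, k)) | i j k. i < n \<and> j < n \<and> k < n}"
    by (auto simp: line_extension_def de_bruijn_1_def)
  have "(u, v) \<in> parcs ?G \<longleftrightarrow> (\<exists>i<n. \<exists>j<n. \<exists>k<n. u = ?E (i, j) \<and> v = ?E (j, k))" for u v
  proof -
    have "(u, v) \<in> parcs ?G \<longleftrightarrow> u \<in> matrix_units n \<and> v \<in> matrix_units n \<and>
        (\<exists>i<n. \<exists>k<n. appears_in (matrix_units n) u v (matrix_coproduct n (?E (i, k))))"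
      by (auto simp: geometric_support_def) (auto simp: matrix_units_def)
    also have "\<dots> \<longleftrightarrow> (\<exists>i<n. \<exists>j<n. \<exists>k<n. u = ?E (i, j) \<and> v = ?E (j, k))"
      using appears_in_matrix_coproduct_iff[of _ n _ u v] matrix_unit_in by blast
    finally show ?thesis .
  qed
  then show "parcs ?G = map_prod ?E ?E ` parcs ?H"
    unfolding H by (auto simp: image_iff set_eq_iff)
qed

theorem proposition2p10:
  fixes n :: nat
  assumes "n \<ge> 1"
  shows "(\<exists>(scale :: real \<Rightarrow> (nat \<Rightarrow>\<^sub>0 real) \<Rightarrow> (nat \<Rightarrow>\<^sub>0 real)) L \<Delta> L\<^sub>0.
            coassociative_coalgebra scale L \<Delta> \<and> vector_space.basis_of scale L\<^sub>0 L \<and>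
            digraph_iso (with_proj (geometric_support L\<^sub>0 \<Delta>))
              (with_proj (line_extension (de_bruijn_1 n))))
       \<and> (\<exists>(scale :: complex \<Rightarrow> (nat \<Rightarrow>\<^sub>0 complex) \<Rightarrow> (nat \<Rightarrow>\<^sub>0 complex)) L \<Delta> L\<^sub>0.
            coassociative_coalgebra scale L \<Delta> \<and> vector_space.basis_of scale L\<^sub>0 L \<and>
            digraph_iso (with_proj (geometric_support L\<^sub>0 \<Delta>))
              (with_proj (line_extension (de_bruijn_1 n))))"
  by (intro conjI exI; rule coassociative_matrix_coalgebra basis_of_matrix_space
      geometric_support_matrix_coalgebra)

end
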